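(* For every symmetric probability measure $m$ on $\mathbb{R}$, every logarithmically convex function $f$ on $\mathbb{R}$, and every $r\in(0,1]$, $$\|f_r\|_{1/r,m}\le\|f\|_{1,m},$$ where $f_r(x)=f(rx)$.
   Context: A probability measure $m$ on $\mathbb{R}$ is symmetric if it is invariant under $x\mapsto -x$. A function $f:\mathbb{R}\to(0,\infty)$ is logarithmically convex if $\log f$ is convex. For $0<p<\infty$, $\|f\|_{p,m}=(\int|f|^p\,dm)^{1/p}\in[0,\infty]$. *)

theory Defs
  imports "HOL-Probability.Probability"
begin

definition symmetric_measure :: "real measure \<Rightarrow> bool" where
  "symmetric_measure m \<longleftrightarrow> distr m borel uminus = m"

definition log_convex :: "(real \<Rightarrow> real) \<Rightarrow> bool" where
  "log_convex f \<longleftrightarrow> (\<forall>x. 0 < f x) \<and> convex_on UNIV (\<lambda>x. ln (f x))"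

text \<open>Real powers on \<open>[0,\<infinity>]\<close>, intended for positive exponents only; then \<open>\<infinity>\<close> to the power \<open>a\<close>
  is \<open>\<infinity>\<close> and 0 to the power \<open>a\<close> is 0.\<close>
definition ennreal_powr :: "ennreal \<Rightarrow> real \<Rightarrow> ennreal" where
  "ennreal_powr x a = (if x = \<infinity> then \<infinity> else ennreal (enn2real x powr a))"

text \<open>The norm takes values in \<open>[0,\<infinity>]\<close>, so that no integrability assumption is needed;
  meaningful for \<open>0 < p\<close> and Borel measurable \<open>f\<close>.\<close>
definition Lp_norm :: "real \<Rightarrow> real measure \<Rightarrow> (real \<Rightarrow> real) \<Rightarrow> ennreal" where
  "Lp_norm p m f = ennreal_powr (\<integral>\<^sup>+ x. ennreal (\<bar>f x\<bar> powr p) \<partial>m) (1 / p)"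

end

theory Submission
  imports Defs
begin

text \<open>Write \<open>p = 1 / r\<close>. Log-convexity along \<open>r x = (1 - r) 0 + r x\<close> gives the pointwise bound
  \<open>f (r x)\<^sup>p \<le> f (0)\<^sup>p\<^sup>-\<^sup>1 f (x)\<close>, and along \<open>0 = (x + (- x)) / 2\<close> it gives
  \<open>2 f (0) \<le> f (x) + f (- x)\<close>. Integrating the latter against the symmetric measure shows that
  \<open>f (0) \<le> \<integral> f dm\<close>, and integrating the former then yields
  \<open>\<integral> f (r x)\<^sup>p dm \<le> (\<integral> f dm)\<^sup>p\<close>.\<close>

lemma log_convex_pos: "log_convex f \<Longrightarrow> 0 < f x"
  by (simp add: log_convex_def)

text \<open>A finite convex function on an open set is continuous, hence so is \<open>f\<close> as
  the exponential of \<open>ln (f x)\<close>. The integrals below thus need no separate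
  measurability assumption on \<open>f\<close>.\<close>

lemma borel_measurable_log_convex:
  assumes "log_convex f"
  shows "f \<in> borel_measurable borel"
proof -
  have "continuous_on UNIV (\<lambda>x. ln (f x))"
    using assms convex_on_continuous[OF open_UNIV] by (auto simp: log_convex_def)
  then have "continuous_on UNIV (\<lambda>x. exp (ln (f x)))"
    by (rule continuous_on_exp)
  then have "continuous_on UNIV f"
    using log_convex_pos[OF assms] by simp
  then show ?thesis
    by (rule borel_measurable_continuous_onI)
qed

lemma log_convex_convex_combination:
  assumes "log_convex f" "0 \<le> t" "t \<le> 1"
  shows "f ((1 - t) * x + t * y) \<le> f x powr (1 - t) * f y powr t"
proof -
  note pos = log_convex_pos[OF assms(1)]
  have "ln (f ((1 - t) * x + t * y)) \<le> (1 - t) * ln (f x) + t * ln (f y)"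
    using convex_onD[of UNIV "\<lambda>x. ln (f x)" t x y] assms by (simp add: log_convex_def)
  then have "exp (ln (f ((1 - t) * x + t * y))) \<le> exp ((1 - t) * ln (f x) + t * ln (f y))"
    by simp
  then show ?thesis
    using pos by (simp add: powr_def exp_add less_imp_neq[THEN not_sym])
qed

lemma log_convex_dilation_powr_le:
  assumes "log_convex f" "0 < r" "r \<le> 1"
  shows "f (r * x) powr (1 / r) \<le> f 0 powr (1 / r - 1) * f x"
proof -
  have pos: "0 < f y" for y
    using assms(1) by (rule log_convex_pos)
  have "f (r * x) \<le> f 0 powr (1 - r) * f x powr r"
    using log_convex_convex_combination[OF assms(1), of r 0 x] assms by simp
  then have "f (r * x) powr (1 / r) \<le> (f 0 powr (1 - r) * f x powr r) powr (1 / r)"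
    using assms pos[of "r * x"] by (intro powr_mono2) auto
  also have "\<dots> = f 0 powr (1 / r - 1) * f x"
    using assms pos[of x] by (simp add: powr_mult powr_powr diff_divide_distrib)
  finally show ?thesis .
qed

text \<open>Log-convexity at the midpoint of \<open>x\<close> and \<open>- x\<close> yields the
  geometric mean; AM-GM then replaces it by the arithmetic mean, which is additive and so can be
  integrated term by term.\<close>

lemma log_convex_zero_le:
  assumes "log_convex f"
  shows "2 * f 0 \<le> f x + f (- x)"
proof -
  have pos: "0 < f y" for y
    using assms by (rule log_convex_pos)
  have "f 0 \<le> f x powr (1 / 2) * f (- x) powr (1 / 2)"
    using log_convex_convex_combination[OF assms, of "1/2" x "- x"] by simp
  also have "\<dots> = sqrt (f x * f (- x))"
    using pos[of x] pos[of "- x"] by (simp add: powr_half_sqrt real_sqrt_mult)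
  also have "\<dots> \<le> (f x + f (- x)) / 2"
    using pos[of x] pos[of "- x"] by (intro arith_geo_mean_sqrt) auto
  finally show ?thesis by simp
qed

lemma nn_integral_symmetric_measure:
  assumes "symmetric_measure m" "sets m = sets borel" "g \<in> borel_measurable borel"
  shows "(\<integral>\<^sup>+ x. g (- x) \<partial>m) = (\<integral>\<^sup>+ x. g x \<partial>m)"
proof -
  have "uminus \<in> m \<rightarrow>\<^sub>M (borel :: real measure)"
    using assms(2) by (simp add: measurable_cong_sets[OF assms(2) refl])
  then have "(\<integral>\<^sup>+ x. g x \<partial>distr m borel uminus) = (\<integral>\<^sup>+ x. g (- x) \<partial>m)"
    using assms(3) by (intro nn_integral_distr) auto
  then show ?thesis
    using assms(1) by (simp add: symmetric_measure_def)
qed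

lemma log_convex_zero_le_nn_integral:
  assumes "prob_space m" "sets m = sets borel" "symmetric_measure m" "log_convex f"
  shows "ennreal (f 0) \<le> (\<integral>\<^sup>+ x. ennreal (f x) \<partial>m)"
proof -
  interpret prob_space m by fact
  note [measurable_cong] = assms(2)
  note [measurable] = borel_measurable_log_convex[OF assms(4)]
  have nonneg: "0 \<le> f x" for x
    using log_convex_pos[OF assms(4)] by (rule less_imp_le)
  \<comment> \<open>Total mass 1 makes a constant equal to its own integral. Working in
    \<open>ennreal\<close> lets the argument go through even if \<open>f\<close> has infinite
    integral.\<close>
  have "2 * ennreal (f 0) = (\<integral>\<^sup>+ x. ennreal (2 * f 0) \<partial>m)"
    using nonneg by (simp add: emeasure_space_1 ennreal_mult)
  also have "\<dots> \<le> (\<integral>\<^sup>+ x. ennreal (f x) + ennreal (f (- x)) \<partial>m)"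
    using log_convex_zero_le[OF assms(4)] nonneg
    by (intro nn_integral_mono) (simp flip: ennreal_plus)
  also have "\<dots> = (\<integral>\<^sup>+ x. ennreal (f x) \<partial>m) + (\<integral>\<^sup>+ x. ennreal (f (- x)) \<partial>m)"
    by (intro nn_integral_add) measurable
  also have "\<dots> = 2 * (\<integral>\<^sup>+ x. ennreal (f x) \<partial>m)"
    using nn_integral_symmetric_measure[OF assms(3,2), of "\<lambda>x. ennreal (f x)"]
    by (simp add: mult_2)
  finally show ?thesis
    by (simp add: ennreal_mult_le_mult_iff)
qed

theorem proposition4p2:
  fixes m :: "real measure" and f :: "real \<Rightarrow> real" and r :: real
  assumes "prob_space m"
    and "sets m = sets borel"
    and "symmetric_measure m"
    and "log_convex f"
    and "0 < r" and "r \<le> 1"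
  shows "Lp_norm (1 / r) m (\<lambda>x. f (r * x)) \<le> Lp_norm 1 m f"
proof -
  define I where "I = (\<integral>\<^sup>+ x. ennreal (f x) \<partial>m)"
  define A where "A = (\<integral>\<^sup>+ x. ennreal (f (r * x) powr (1 / r)) \<partial>m)"
  have nonneg: "0 \<le> f x" for x
    using log_convex_pos[OF assms(4)] by (rule less_imp_le)
  have lhs: "Lp_norm (1 / r) m (\<lambda>x. f (r * x)) = ennreal_powr A r"
    using nonneg by (simp add: Lp_norm_def A_def)
  have rhs: "Lp_norm 1 m f = ennreal_powr I 1"
    using nonneg by (simp add: Lp_norm_def I_def)
  show ?thesis
  proof (cases I)
    \<comment> \<open>Here the right-hand side is infinite, since \<open>ennreal_powr\<close> fixes
      infinity.\<close>
    case top
    then show ?thesis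
      unfolding rhs by (simp add: ennreal_powr_def)
  next
    case (real J)
    note [measurable_cong] = assms(2)
    note [measurable] = borel_measurable_log_convex[OF assms(4)]
    have f0_le: "f 0 \<le> J"
      using log_convex_zero_le_nn_integral[OF assms(1-4)] real by (simp add: I_def)
    then have J_pos: "0 < J"
      using log_convex_pos[OF assms(4), of 0] by linarith
    have "A \<le> (\<integral>\<^sup>+ x. ennreal (f 0 powr (1 / r - 1)) * ennreal (f x) \<partial>m)"
      unfolding A_def
      using log_convex_dilation_powr_le[OF assms(4-6)] nonneg
      by (intro nn_integral_mono) (simp flip: ennreal_mult)
    also have "\<dots> = ennreal (f 0 powr (1 / r - 1)) * I"
      unfolding I_def by (intro nn_integral_cmult) measurable
    also have "\<dots> = ennreal (f 0 powr (1 / r - 1) * J)"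
      using real by (simp add: ennreal_mult)
    \<comment> \<open>As \<open>r \<le> 1\<close>, the exponent \<open>1 / r - 1\<close> is
      nonnegative, so \<open>f 0 \<le> J\<close> survives the power. The factor \<open>J\<close> is
      written as \<open>J powr 1\<close> so that the exponents add up to
      \<open>1 / r\<close>.\<close>
    also have "\<dots> \<le> ennreal (J powr (1 / r - 1) * J powr 1)"
      using f0_le J_pos nonneg assms(5,6)
      by (intro ennreal_leI mult_mono powr_mono2) (auto simp: field_simps)
    also have "\<dots> = ennreal (J powr (1 / r))"
      by (subst powr_add[symmetric]) simp
    finally have A_le: "A \<le> ennreal (J powr (1 / r))" .
    \<comment> \<open>Finiteness selects the branch of \<open>ennreal_powr\<close> that goes through
      \<open>enn2real\<close>; taking the power \<open>r\<close> then undoes the exponent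
      \<open>1 / r\<close>.\<close>
    then have "A \<noteq> \<infinity>"
      by (auto simp: top_unique)
    have "enn2real A \<le> J powr (1 / r)"
      using enn2real_mono[OF A_le] by simp
    then have "enn2real A powr r \<le> (J powr (1 / r)) powr r"
      using assms(5) by (intro powr_mono2) auto
    also have "\<dots> = J"
      using assms(5) J_pos by (simp add: powr_powr)
    finally show ?thesis
      unfolding lhs rhs using \<open>A \<noteq> \<infinity>\<close> real J_pos
      by (simp add: ennreal_powr_def ennreal_leI)
  qed
qed

end
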